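(* Let $R$ be a ring. Then the following are equivalent: (1) $R$ is an abelian periodic ring. (2) For any $a\in R$, there exists some $m\in\mathbb{N}$ such that $a^m\in R$ is uniquely nil clean.
   Context: All rings are associative with identity, not necessarily commutative. $\mathbb{N}$ denotes the positive integers. A ring is abelian if every idempotent in it is central. A ring $R$ is periodic if for any $a\in R$ there exist distinct $m,n\in\mathbb{N}$ such that $a^m=a^n$. An element $a\in R$ is uniquely nil clean if there exists a unique idempotent $e\in R$ such that $a-e$ is nilpotent. *)

theory Defs
  imports "HOL-Algebra.Ring"
begin

text \<open>
  The locale \<open>ring\<close> of HOL-Algebra describes associative rings with identity that need not be
  commutative; the zero ring is included.  Exponents satisfy \<open>0 < n\<close> because they range over
  the positive integers.
\<close>

definition ring_idempotent :: "('a, 'b) ring_scheme \<Rightarrow> 'a \<Rightarrow> bool" where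
  "ring_idempotent R e \<longleftrightarrow> e \<in> carrier R \<and> e \<otimes>\<^bsub>R\<^esub> e = e"

definition ring_nilpotent :: "('a, 'b) ring_scheme \<Rightarrow> 'a \<Rightarrow> bool" where
  "ring_nilpotent R x \<longleftrightarrow> x \<in> carrier R \<and> (\<exists>n::nat. 0 < n \<and> x [^]\<^bsub>R\<^esub> n = \<zero>\<^bsub>R\<^esub>)"

definition ring_central :: "('a, 'b) ring_scheme \<Rightarrow> 'a \<Rightarrow> bool" where
  "ring_central R c \<longleftrightarrow>
     c \<in> carrier R \<and> (\<forall>x \<in> carrier R. c \<otimes>\<^bsub>R\<^esub> x = x \<otimes>\<^bsub>R\<^esub> c)"

text \<open>
  Abelian in the ring-theoretic sense; this is unrelated to the locale \<open>abelian_group\<close>, which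
  every ring satisfies, and weaker than commutativity.
\<close>

definition abelian_ring :: "('a, 'b) ring_scheme \<Rightarrow> bool" where
  "abelian_ring R \<longleftrightarrow> ring R \<and> (\<forall>e. ring_idempotent R e \<longrightarrow> ring_central R e)"

definition periodic_ring :: "('a, 'b) ring_scheme \<Rightarrow> bool" where
  "periodic_ring R \<longleftrightarrow> ring R \<and>
     (\<forall>a \<in> carrier R. \<exists>m n::nat. 0 < m \<and> 0 < n \<and> m \<noteq> n \<and> a [^]\<^bsub>R\<^esub> m = a [^]\<^bsub>R\<^esub> n)"

definition uniquely_nil_clean :: "('a, 'b) ring_scheme \<Rightarrow> 'a \<Rightarrow> bool" where
  "uniquely_nil_clean R a \<longleftrightarrow> a \<in> carrier R \<and>
     (\<exists>!e. ring_idempotent R e \<and> ring_nilpotent R (a \<ominus>\<^bsub>R\<^esub> e))"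

end

theory Submission
  imports Defs "HOL-Algebra.Multiplicative_Group"
begin

text \<open>
  For the forward direction, a power of \<open>a\<close> is idempotent, and two commuting idempotents with
  nilpotent difference agree because \<open>(e - f)\<^sup>3 = e - f\<close>.

  Conversely, an idempotent \<open>e\<close> is its own nil clean part, and so are \<open>e + e x (1 - e)\<close> and
  \<open>e + (1 - e) x e\<close>; uniqueness makes \<open>e\<close> central. A nil clean power \<open>g\<close> of \<open>2\<close> has \<open>g (g - 1)\<close>
  nilpotent, so the characteristic \<open>N\<close> is positive. Finally, if \<open>a\<^sup>m = e + w\<close> with \<open>w\<close> nilpotent, then
  \<open>(e + w)\<^sup>N - e\<close> is a multiple of \<open>w\<^sup>2\<close>, and iterating this shows that a power of \<open>a\<^sup>m\<close> equals \<open>e\<close>.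
\<close>

context ring
begin

section \<open>Powers, multiples of one and nilpotent products\<close>

lemma add_minus_cancel:
  assumes "x \<in> carrier R" "y \<in> carrier R"
  shows "x \<oplus> (y \<oplus> \<ominus> x) = y"
  using assms by (metis a_lcomm a_inv_closed r_neg r_zero)

lemma nat_pow_zero_le:
  assumes "x \<in> carrier R" "x [^] (n::nat) = \<zero>" "n \<le> k"
  shows "x [^] k = \<zero>"
proof -
  have "x [^] k = x [^] n \<otimes> x [^] (k - n)"
    using nat_pow_mult[OF assms(1), of n "k - n"] assms(3) by simp
  then show ?thesis using assms by simp
qed

lemma add_pow_one_mult:
  "([a] \<cdot> \<one>) \<otimes> ([b] \<cdot> \<one>) = [(a * b :: nat)] \<cdot> \<one>"
  by (simp add: add_pow_ldistr add.nat_pow_pow mult.commute)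

lemma add_pow_one_nat_pow:
  "([a] \<cdot> \<one>) [^] (n::nat) = [(a ^ n :: nat)] \<cdot> \<one>"
  by (induction n) (simp_all add: add_pow_one_mult mult.commute)

lemma ring_nilpotent_mult:
  assumes "ring_nilpotent R v" "c \<in> carrier R" "v \<otimes> c = c \<otimes> v"
  shows "ring_nilpotent R (v \<otimes> c)"
proof -
  obtain n :: nat where n: "0 < n" "v [^] n = \<zero>" and v: "v \<in> carrier R"
    using assms(1) unfolding ring_nilpotent_def by blast
  have "(v \<otimes> c) [^] n = v [^] n \<otimes> c [^] n"
    by (rule pow_mult_distrib) (use v assms in simp_all)
  then show ?thesis
    using n v assms(2) unfolding ring_nilpotent_def by auto
qed

lemma ring_idempotent_nat_pow:
  assumes "ring_idempotent R e" "0 < (n::nat)"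
  shows "e [^] n = e"
  using assms(2)
proof (induction n)
  case (Suc n)
  then show ?case
    using assms(1) unfolding ring_idempotent_def by (cases "n = 0") auto
qed simp

section \<open>Comparing and producing idempotents\<close>

lemma commuting_idempotents_eq:
  assumes e: "ring_idempotent R e" and f: "ring_idempotent R f"
    and comm: "e \<otimes> f = f \<otimes> e" and nil: "ring_nilpotent R (e \<ominus> f)"
  shows "e = f"
proof -
  have c: "e \<in> carrier R" "f \<in> carrier R" "e \<otimes> e = e" "f \<otimes> f = f"
    using e f unfolding ring_idempotent_def by auto
  define d where "d = e \<ominus> f"
  have d: "d \<in> carrier R" using c by (simp add: d_def)
  have fe: "f \<otimes> (e \<otimes> f) = e \<otimes> f"
    using c comm by (metis m_assoc)
  have ef: "e \<otimes> (e \<otimes> f) = e \<otimes> f" "f \<otimes> e = e \<otimes> f"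
    using c comm by (metis m_assoc) (simp add: comm)
  have d2: "d \<otimes> d = e \<oplus> f \<ominus> (e \<otimes> f \<oplus> e \<otimes> f)"
    using c ef by (simp add: d_def minus_eq l_distr r_distr l_minus r_minus minus_add a_ac)
  have d3: "d \<otimes> d \<otimes> d = d"
    unfolding d2 unfolding d_def using c ef fe
    by (simp add: minus_eq l_distr r_distr l_minus r_minus minus_add m_assoc a_ac r_neg r_neg1 r_neg2)
  have odd: "d [^] (2 * k + 1 :: nat) = d" for k
  proof (induction k)
    case (Suc k)
    have "d [^] (2 * Suc k + 1 :: nat) = d [^] (2 * k + 1 :: nat) \<otimes> d \<otimes> d" by simp
    then show ?case using Suc d3 by simp
  qed (simp add: d)
  obtain n :: nat where "d [^] n = \<zero>"
    using nil unfolding ring_nilpotent_def d_def by blast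
  \<comment> \<open>The exponent 2n + 1 is odd, so this power is \<open>d\<close>, and at least
    \<open>n\<close>, so it vanishes.\<close>
  then have "d [^] (2 * n + 1) = \<zero>" using d by (rule_tac nat_pow_zero_le) auto
  then have "d = \<zero>" using odd by simp
  then show ?thesis using c unfolding d_def by (simp add: r_right_minus_eq)
qed

text \<open>From exponent \<open>m\<close> on, the powers of \<open>a\<close> repeat with period
  \<open>p = n - m\<close>. The exponent \<open>m * p\<close> is a multiple of the period and at
  least \<open>m\<close>, so doubling it does not change the power.\<close>

lemma periodic_idempotent_power:
  assumes a: "a \<in> carrier R" and mn: "0 < m" "(m::nat) < n" and eq: "a [^] m = a [^] n"
  shows "\<exists>k::nat. 0 < k \<and> ring_idempotent R (a [^] k)"
proof -
  define p where "p = n - m"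
  have shift: "a [^] (i + p) = a [^] i" if "m \<le> i" for i
  proof -
    have "a [^] (i + p) = a [^] n \<otimes> a [^] (i - m)"
      using a mn that by (simp add: nat_pow_mult p_def add.commute)
    also have "\<dots> = a [^] i"
      using a that by (simp add: nat_pow_mult eq[symmetric])
    finally show ?thesis .
  qed
  have shifts: "a [^] (i + j * p) = a [^] i" if "m \<le> i" for i j
  proof (induction j)
    case (Suc j)
    have "a [^] (i + Suc j * p) = a [^] ((i + j * p) + p)" by (simp add: ac_simps)
    then show ?case using shift[of "i + j * p"] that Suc by simp
  qed simp
  have "m \<le> m * p" "0 < m * p" using mn by (auto simp: p_def)
  moreover have "a [^] (m * p) \<otimes> a [^] (m * p) = a [^] (m * p)"
    using shifts[of "m * p" m] \<open>m \<le> m * p\<close> a by (simp add: nat_pow_mult)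
  ultimately show ?thesis using a unfolding ring_idempotent_def by blast
qed

section \<open>Centrality of idempotents from uniqueness\<close>

text \<open>The conditions on \<open>y\<close> make \<open>e + y\<close> idempotent, and it differs
  from \<open>e\<close> by the nilpotent \<open>-y\<close>. Both \<open>e\<close> and
  \<open>e + y\<close> are then nil clean parts of \<open>e\<close>.\<close>

lemma uniquely_nil_clean_square_zero_perturbation:
  assumes e: "ring_idempotent R e" and y: "y \<in> carrier R" "y \<otimes> y = \<zero>"
    and ey: "e \<otimes> y \<oplus> y \<otimes> e = y"
    and uniq: "uniquely_nil_clean R e"
  shows "y = \<zero>"
proof -
  have c: "e \<in> carrier R" "e \<otimes> e = e" using e unfolding ring_idempotent_def by auto
  have "(e \<oplus> y) \<otimes> (e \<oplus> y) = e \<oplus> (e \<otimes> y \<oplus> y \<otimes> e)"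
    using c y by (simp add: l_distr r_distr a_ac)
  then have id: "ring_idempotent R (e \<oplus> y)"
    using ey c y unfolding ring_idempotent_def by simp
  have diff: "e \<ominus> (e \<oplus> y) = \<ominus> y"
    using c y by (simp add: minus_eq minus_add r_neg1 r_neg2)
  have "(\<ominus> y) [^] (2::nat) = \<zero>"
    using y by (simp add: numeral_2_eq_2 l_minus r_minus)
  then have nil: "ring_nilpotent R (e \<ominus> (e \<oplus> y))"
    unfolding diff ring_nilpotent_def using y by (metis a_inv_closed zero_less_numeral)
  have "ring_nilpotent R (e \<ominus> e)"
    using c unfolding ring_nilpotent_def by (auto simp: minus_eq r_neg intro!: exI[of _ "1::nat"])
  then have "e \<oplus> y = e"
    using uniq e id nil unfolding uniquely_nil_clean_def by blast
  then show ?thesis using c y by simp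
qed

lemma uniquely_nil_clean_idempotent_central:
  assumes e: "ring_idempotent R e" and uniq: "uniquely_nil_clean R e"
  shows "ring_central R e"
proof -
  have c: "e \<in> carrier R" "e \<otimes> e = e" using e unfolding ring_idempotent_def by auto
  have ee: "e \<otimes> (e \<otimes> z) = e \<otimes> z" if "z \<in> carrier R" for z
    using c that by (simp add: m_assoc[symmetric])
  have "e \<otimes> x = x \<otimes> e" if x: "x \<in> carrier R" for x
  proof -
    \<comment> \<open>Here y = e x (1 - e) satisfies e y = y and y e = 0, hence y y = 0. For (1 - e)
      x e below the two sides swap roles; together they give e x = e x e = x e.\<close>
    have "e \<otimes> x \<ominus> e \<otimes> x \<otimes> e = \<zero>"
      by (rule uniquely_nil_clean_square_zero_perturbation[OF e _ _ _ uniq])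
        (use c x ee in \<open>simp_all add: minus_eq l_distr r_distr l_minus r_minus m_assoc
           r_neg l_neg a_ac r_neg1 r_neg2 minus_add\<close>)
    moreover have "x \<otimes> e \<ominus> e \<otimes> x \<otimes> e = \<zero>"
      by (rule uniquely_nil_clean_square_zero_perturbation[OF e _ _ _ uniq])
        (use c x ee in \<open>simp_all add: minus_eq l_distr r_distr l_minus r_minus m_assoc
           r_neg l_neg a_ac r_neg1 r_neg2 minus_add\<close>)
    ultimately show ?thesis using c x by (simp add: r_right_minus_eq)
  qed
  then show ?thesis using c unfolding ring_central_def by blast
qed

section \<open>Positive characteristic\<close>

lemma positive_characteristic:
  assumes m: "0 < (m::nat)" and e: "ring_idempotent R e" "ring_central R e"
    and nil: "ring_nilpotent R (([(2::nat)] \<cdot> \<one>) [^] m \<ominus> e)"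
  shows "\<exists>N\<ge>2. [(N::nat)] \<cdot> \<one> = \<zero>"
proof -
  define q :: nat where "q = 2 ^ m"
  have q: "2 \<le> q" using m unfolding q_def by (cases m) auto
  define g where "g = [q] \<cdot> \<one>"
  have g: "g \<in> carrier R" by (simp add: g_def)
  have c: "e \<in> carrier R" "e \<otimes> e = e" using e unfolding ring_idempotent_def by auto
  have ge: "e \<otimes> g = g \<otimes> e" using e(2) g unfolding ring_central_def by blast
  define v where "v = g \<ominus> e"
  have v: "v \<in> carrier R" "ring_nilpotent R v"
    using nil g c by (simp_all add: v_def g_def q_def add_pow_one_nat_pow)
  \<comment> \<open>The cofactor of \<open>v\<close> in g (g - 1): since \<open>e\<close> is
    idempotent and commutes with \<open>g\<close>, (g - e)(g + e - 1) = g g - g.\<close>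
  define b where "b = g \<oplus> e \<ominus> \<one>"
  have b: "b \<in> carrier R" using g c by (simp add: b_def)
  have g1: "g \<ominus> \<one> = [(q - 1)] \<cdot> \<one>"
  proof -
    have "g = [(q - 1)] \<cdot> \<one> \<oplus> \<one>"
      using q by (cases q) (simp_all add: g_def)
    then show ?thesis by (simp add: minus_eq a_assoc r_neg)
  qed
  have vb: "v \<otimes> b = b \<otimes> v" "v \<otimes> b = g \<otimes> (g \<ominus> \<one>)"
    unfolding v_def b_def using c g ge
    by (simp_all add: minus_eq l_distr r_distr l_minus r_minus minus_add a_ac r_neg l_neg r_neg1 r_neg2
      add_minus_cancel)
  have "ring_nilpotent R (v \<otimes> b)"
    using ring_nilpotent_mult v b vb(1) by blast
  moreover have "v \<otimes> b = [(q * (q - 1))] \<cdot> \<one>"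
    unfolding vb(2) g1 by (simp add: g_def add_pow_one_mult)
  ultimately obtain n :: nat where n: "0 < n" "[((q * (q - 1)) ^ n)] \<cdot> \<one> = \<zero>"
    unfolding ring_nilpotent_def by (auto simp only: add_pow_one_nat_pow)
  \<comment> \<open>Excludes the values 0 and 1 for \<open>N\<close>; the expansion of the
    \<open>N\<close>-th power used later starts at exponent 2.\<close>
  have "2 * 1 \<le> q * (q - 1)" using q by (intro mult_le_mono) auto
  then have "2 \<le> (q * (q - 1)) ^ n"
    using self_le_power[of "q * (q - 1)" n] n(1) by linarith
  then show ?thesis using n(2) by blast
qed

section \<open>Expansion of powers around an idempotent\<close>

text \<open>A binomial expansion modulo w^2, where every power of \<open>e\<close> collapses to
  \<open>e\<close>. It starts at exponent 2 because at exponent 1 the linear term is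
  \<open>w\<close>, not \<open>e w\<close>. The cofactor \<open>d\<close> commutes with
  \<open>w\<close> so that powers of \<open>w w d\<close> can be split later.\<close>

lemma idempotent_plus_pow:
  assumes c: "e \<in> carrier R" "w \<in> carrier R" and ee: "e \<otimes> e = e" and ew: "w \<otimes> e = e \<otimes> w"
  shows "\<exists>d\<in>carrier R. d \<otimes> w = w \<otimes> d \<and>
    (e \<oplus> w) [^] (k + 2 :: nat) = e \<oplus> [(k + 2)] \<cdot> (e \<otimes> w) \<oplus> w \<otimes> w \<otimes> d"
proof (induction k)
  case 0
  have "(e \<oplus> w) [^] (0 + 2 :: nat) = e \<oplus> [(0 + 2::nat)] \<cdot> (e \<otimes> w) \<oplus> w \<otimes> w \<otimes> \<one>"
    using c ee ew by (simp add: numeral_2_eq_2 l_distr r_distr a_ac)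
  then show ?case using c by (intro bexI[of _ \<one>]) auto
next
  case (Suc k)
  then obtain d where d: "d \<in> carrier R" "d \<otimes> w = w \<otimes> d"
    and IH: "(e \<oplus> w) [^] (k + 2 :: nat) = e \<oplus> [(k + 2)] \<cdot> (e \<otimes> w) \<oplus> w \<otimes> w \<otimes> d"
    by blast
  define s where "s = [(k + 2)] \<cdot> e"
  have s: "s \<in> carrier R" "s \<otimes> w = w \<otimes> s" "s \<otimes> e = e \<otimes> s"
    using c ew by (simp_all add: s_def add_pow_ldistr add_pow_rdistr del: add.nat_pow_Suc add_2_eq_Suc')
  have se: "s \<otimes> e = s" using c ee by (simp add: s_def add_pow_ldistr del: add.nat_pow_Suc add_2_eq_Suc')
  have sw: "[(k + 2)] \<cdot> (e \<otimes> w) = s \<otimes> w"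
    using c by (simp add: s_def add_pow_ldistr del: add.nat_pow_Suc add_2_eq_Suc')
  have sw': "[(Suc k + 2)] \<cdot> (e \<otimes> w) = s \<otimes> w \<oplus> e \<otimes> w"
    using c sw by simp
  have t: "s \<otimes> w \<otimes> e = s \<otimes> w"
    using c s se ew by (metis m_assoc)
  have t2: "s \<otimes> w \<otimes> w = w \<otimes> w \<otimes> s"
    using c s by (metis m_assoc)
  \<comment> \<open>The new multiples of w^2 are \<open>s w w\<close>, from the linear term times
    \<open>w\<close>, and the old remainder times \<open>e + w\<close>.\<close>
  define d' where "d' = s \<oplus> d \<otimes> (e \<oplus> w)"
  have "(e \<oplus> w) [^] (Suc k + 2 :: nat) = (e \<oplus> s \<otimes> w \<oplus> w \<otimes> w \<otimes> d) \<otimes> (e \<oplus> w)"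
    using IH sw by simp
  also have "\<dots> = (e \<oplus> s \<otimes> w) \<otimes> (e \<oplus> w) \<oplus> w \<otimes> w \<otimes> (d \<otimes> (e \<oplus> w))"
    using c s d by (simp add: l_distr m_assoc)
  also have "(e \<oplus> s \<otimes> w) \<otimes> (e \<oplus> w) = e \<oplus> (s \<otimes> w \<oplus> e \<otimes> w) \<oplus> w \<otimes> w \<otimes> s"
    using c s ee t t2 by (simp add: l_distr r_distr a_ac)
  finally have "(e \<oplus> w) [^] (Suc k + 2 :: nat)
      = e \<oplus> [(Suc k + 2)] \<cdot> (e \<otimes> w) \<oplus> w \<otimes> w \<otimes> d'"
    unfolding sw' d'_def using c s d by (simp add: r_distr a_assoc)
  moreover have "d' \<otimes> w = w \<otimes> d'"
  proof -
    have "d \<otimes> (e \<oplus> w) \<otimes> w = w \<otimes> (d \<otimes> (e \<oplus> w))"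
    proof -
      have "(e \<oplus> w) \<otimes> w = w \<otimes> (e \<oplus> w)" using c ew by (simp add: l_distr r_distr)
      then show ?thesis using c d by (metis m_assoc a_closed)
    qed
    then show ?thesis using c s d by (simp add: d'_def l_distr r_distr)
  qed
  moreover have "d' \<in> carrier R" using c s d by (simp add: d'_def)
  ultimately show ?case by blast
qed

text \<open>With w = x - e, the linear term of x^N is a multiple of \<open>N\<close> times one and
  vanishes, so x^N - e = w w d. Passing from \<open>x\<close> to x^N therefore halves the nilpotency
  exponent; taking it as a power of two lets the induction end at exponent 1, where x = e.\<close>

lemma nil_clean_power_idempotent:
  assumes N: "2 \<le> N" "[(N::nat)] \<cdot> \<one> = \<zero>"
    and e: "ring_idempotent R e" "ring_central R e"
    and x: "x \<in> carrier R" "(x \<ominus> e) [^] (2 ^ j :: nat) = \<zero>"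
  shows "\<exists>K::nat. 0 < K \<and> x [^] K = e"
  using x
proof (induction j arbitrary: x)
  case 0
  then have "x = e"
    using e unfolding ring_idempotent_def by (simp add: r_right_minus_eq)
  then show ?case using e unfolding ring_idempotent_def by (intro exI[of _ "1::nat"]) simp
next
  case (Suc j)
  have c: "e \<in> carrier R" "e \<otimes> e = e" using e unfolding ring_idempotent_def by auto
  define w where "w = x \<ominus> e"
  have w: "w \<in> carrier R" "e \<oplus> w = x" "w [^] (2 ^ Suc j :: nat) = \<zero>"
    using Suc.prems c by (simp_all add: w_def minus_eq add_minus_cancel)
  have ew: "w \<otimes> e = e \<otimes> w" using e(2) w unfolding ring_central_def by simp
  obtain d where d: "d \<in> carrier R" "d \<otimes> w = w \<otimes> d"
    and pow: "x [^] N = e \<oplus> [N] \<cdot> (e \<otimes> w) \<oplus> w \<otimes> w \<otimes> d"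
    using idempotent_plus_pow[OF c(1) w(1) c(2) ew, of "N - 2"]
    unfolding le_add_diff_inverse2[OF N(1)] w(2) by blast
  have "[N] \<cdot> (e \<otimes> w) = ([N] \<cdot> \<one>) \<otimes> (e \<otimes> w)"
    using c(1) w(1) by (simp add: add_pow_ldistr)
  then have "x [^] N = e \<oplus> w \<otimes> w \<otimes> d" using pow N(2) c(1) w(1) d(1) by simp
  then have diff: "x [^] N \<ominus> e = w \<otimes> w \<otimes> d"
    using c(1) w(1) d(1) by (simp add: minus_eq a_assoc add_minus_cancel)
  have "w \<otimes> w \<otimes> d = d \<otimes> (w \<otimes> w)"
    using w(1) d by (metis m_assoc)
  then have "(x [^] N \<ominus> e) [^] (2 ^ j :: nat) = (w \<otimes> w) [^] (2 ^ j :: nat) \<otimes> d [^] (2 ^ j :: nat)"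
    unfolding diff using w(1) d(1) by (intro pow_mult_distrib) simp_all
  also have "(w \<otimes> w) [^] (2 ^ j :: nat) = w [^] (2 ^ Suc j :: nat)"
  proof -
    have "w \<otimes> w = w [^] (2::nat)" using w(1) by (simp add: numeral_2_eq_2)
    then show ?thesis using w(1) by (simp add: nat_pow_pow)
  qed
  finally have "(x [^] N \<ominus> e) [^] (2 ^ j :: nat) = \<zero>" using w(3) d(1) by simp
  then obtain K :: nat where "0 < K" "(x [^] N) [^] K = e"
    using Suc.IH[of "x [^] N"] Suc.prems by auto
  then show ?case using N(1) Suc.prems(1) by (intro exI[of _ "N * K"]) (simp add: nat_pow_pow)
qed

section \<open>The two implications\<close>

lemma abelian_periodic_imp_nil_clean:
  assumes ab: "abelian_ring R" and per: "periodic_ring R" and a: "a \<in> carrier R"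
  shows "\<exists>m::nat. 0 < m \<and> uniquely_nil_clean R (a [^] m)"
proof -
  obtain m n :: nat where "0 < m" "0 < n" "m \<noteq> n" "a [^] m = a [^] n"
    using per a unfolding periodic_ring_def by blast
  then obtain k :: nat where k: "0 < k" "ring_idempotent R (a [^] k)"
    using periodic_idempotent_power[OF a, of m n] periodic_idempotent_power[OF a, of n m]
    by (metis nat_neq_iff)
  have "ring_nilpotent R (a [^] k \<ominus> a [^] k)"
    using a unfolding ring_nilpotent_def by (auto simp: minus_eq r_neg intro!: exI[of _ "1::nat"])
  \<comment> \<open>Idempotents of an abelian ring are central, so \<open>f\<close> commutes with
    the idempotent \<open>a [^] k\<close> and the nilpotent difference forces equality.\<close>
  moreover have "f = a [^] k"
    if f: "ring_idempotent R f" "ring_nilpotent R (a [^] k \<ominus> f)" for f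
    using commuting_idempotents_eq[OF k(2) f(1) _ f(2)] ab k(2) f(1)
    unfolding abelian_ring_def ring_central_def ring_idempotent_def by metis
  ultimately have "uniquely_nil_clean R (a [^] k)"
    using a k(2) unfolding uniquely_nil_clean_def by (auto intro!: ex1I[of _ "a [^] k"])
  then show ?thesis using k(1) by blast
qed

lemma nil_clean_imp_abelian_periodic:
  assumes unc: "\<forall>a \<in> carrier R. \<exists>m::nat. 0 < m \<and> uniquely_nil_clean R (a [^] m)"
  shows "abelian_ring R \<and> periodic_ring R"
proof -
  \<comment> \<open>All positive powers of \<open>e\<close> equal \<open>e\<close>, so the
    hypothesis makes \<open>e\<close> itself uniquely nil clean.\<close>
  have central: "ring_central R e" if e: "ring_idempotent R e" for e
    using unc e ring_idempotent_nat_pow[OF e] uniquely_nil_clean_idempotent_central[OF e]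
    unfolding ring_idempotent_def by metis
  \<comment> \<open>The hypothesis is applied to the element 2 = 1 + 1.\<close>
  obtain m e where "0 < (m::nat)" "ring_idempotent R e"
    "ring_nilpotent R (([(2::nat)] \<cdot> \<one>) [^] m \<ominus> e)"
    using unc unfolding uniquely_nil_clean_def by (metis add.nat_pow_closed one_closed)
  then obtain N :: nat where N: "2 \<le> N" "[N] \<cdot> \<one> = \<zero>"
    using positive_characteristic central by blast
  have "\<exists>m n::nat. 0 < m \<and> 0 < n \<and> m \<noteq> n \<and> a [^] m = a [^] n" if a: "a \<in> carrier R" for a
  proof -
    obtain m e n where m: "0 < (m::nat)" and e: "ring_idempotent R e"
      and n: "(a [^] m \<ominus> e) [^] (n::nat) = \<zero>"
      using unc a unfolding uniquely_nil_clean_def ring_nilpotent_def by meson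
    \<comment> \<open>As n \<le> 2^n, the nilpotency exponent may be raised to a power of
      two.\<close>
    have "(a [^] m \<ominus> e) [^] (2 ^ n :: nat) = \<zero>"
      by (rule nat_pow_zero_le[OF _ n]) (use a e in \<open>auto simp: ring_idempotent_def\<close>)
    then obtain K :: nat where K: "0 < K" "(a [^] m) [^] K = e"
      using nil_clean_power_idempotent[OF N e central[OF e], of "a [^] m" n] a by auto
    have "a [^] (m * K) = e" using K a by (simp add: nat_pow_pow)
    \<comment> \<open>Idempotence of \<open>e\<close> gives two equal powers, with distinct
      exponents because \<open>m * K\<close> is positive.\<close>
    then have "a [^] (m * K) = a [^] (m * K + m * K)"
      using a e by (simp add: nat_pow_mult[symmetric] ring_idempotent_def)
    moreover have "0 < m * K" using m K by simp
    ultimately show ?thesis by (metis add_gr_0 less_add_same_cancel1 nat_neq_iff)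
  qed
  then show ?thesis
    using central ring_axioms unfolding abelian_ring_def periodic_ring_def by blast
qed

end

theorem lemma4p6:
  fixes R :: "('a, 'b) ring_scheme"
  assumes "ring R"
  shows "(abelian_ring R \<and> periodic_ring R) \<longleftrightarrow>
    (\<forall>a \<in> carrier R. \<exists>m::nat. 0 < m \<and> uniquely_nil_clean R (a [^]\<^bsub>R\<^esub> m))"
  using ring.abelian_periodic_imp_nil_clean[OF assms]
    ring.nil_clean_imp_abelian_periodic[OF assms] by blast

end
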